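(* Let $q\in\mathbb C\setminus\{0\}$, $p\in\mathbb C$, and let $$R=\begin{bmatrix}1&q&-q&-q^2\\0&0&1&q\\0&1&0&-q\\0&0&0&1\end{bmatrix},\qquad S=\begin{bmatrix}1&p&-p&-p^2\\0&0&1&p\\0&1&0&-p\\0&0&0&1\end{bmatrix}.$$ Let $\rho_n$ be the representation of the mixed doubles group $\mathsf{MD}_n$ on $(\mathbb C^2)^{\otimes n}$ given by $r_i\mapsto I_2^{\otimes(i-1)}\otimes R\otimes I_2^{\otimes(n-i-1)}$ and $s_i\mapsto I_2^{\otimes(i-1)}\otimes S\otimes I_2^{\otimes(n-i-1)}$. Then the $\mathsf{MD}_n$ representations $\rho_n$ are indecomposable, except when $q=p$.
   Context: For $n\in\mathbb N$ the mixed doubles group $\mathsf{MD}_n$ is the group with generators $s_1,\dots,s_{n-1},r_1,\dots,r_{n-1}$ and relations $r_ir_{i+1}r_i=r_{i+1}r_ir_{i+1}$, $r_ir_{i+1}s_i=s_{i+1}r_ir_{i+1}$, $r_is_{i+1}s_i=s_{i+1}s_ir_{i+1}$, $s_is_{i+1}s_i=s_{i+1}s_is_{i+1}$, $s_i^2=1$, $r_i^2=1$, and $r_ir_j=r_jr_i$, $s_is_j=s_js_i$, $r_is_j=s_jr_i$ for $|i-j|>1$. The given pair $(R,S)$ (the f-glue variety) does define a representation of $\mathsf{MD}_n$ by the stated formula for every $n$. A representation is indecomposable if it is nonzero and not a direct sum of two nonzero subrepresentations.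
   Formalization: Indecomposability for q ≠ p is stated for n ≥ 3 only, since it fails for n = 1 (trivial group on C²) and n = 2 (e2+e3 and span(e1, e2−e3, e4) split C⁴ for all q, p); for q = p decomposability is stated for n ≥ 1, as n = 0 gives a one-dimensional space. *)

theory Defs
  imports "Jordan_Normal_Form.VS_Connect"
begin

section \<open>Groups given by generators and relations\<close>

text \<open>A letter \<open>(x, b)\<close> stands for the generator \<open>x\<close> if \<open>b = False\<close> and for its formal
  inverse if \<open>b = True\<close>. A relation \<open>(u, v)\<close> imposes \<open>u = v\<close>.\<close>

type_synonym 'g gword = "('g \<times> bool) list"

inductive pres_cong :: "'g set \<Rightarrow> ('g gword \<times> 'g gword) set \<Rightarrow> 'g gword \<Rightarrow> 'g gword \<Rightarrow> bool"
  for X :: "'g set" and Rel :: "('g gword \<times> 'g gword) set" where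
  pc_rel: "(u, v) \<in> Rel \<Longrightarrow> pres_cong X Rel u v"
| pc_cancel: "x \<in> X \<Longrightarrow> pres_cong X Rel [(x, b), (x, \<not> b)] []"
| pc_refl: "u \<in> lists (X \<times> UNIV) \<Longrightarrow> pres_cong X Rel u u"
| pc_sym: "pres_cong X Rel u v \<Longrightarrow> pres_cong X Rel v u"
| pc_trans: "pres_cong X Rel u v \<Longrightarrow> pres_cong X Rel v w \<Longrightarrow> pres_cong X Rel u w"
| pc_append: "pres_cong X Rel u u' \<Longrightarrow> pres_cong X Rel v v' \<Longrightarrow> pres_cong X Rel (u @ v) (u' @ v')"

definition pres_class :: "'g set \<Rightarrow> ('g gword \<times> 'g gword) set \<Rightarrow> 'g gword \<Rightarrow> 'g gword set" where
  "pres_class X Rel u = {v. pres_cong X Rel u v}"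

definition presented_group :: "'g set \<Rightarrow> ('g gword \<times> 'g gword) set \<Rightarrow> 'g gword set monoid" where
  "presented_group X Rel = \<lparr>
     carrier = pres_class X Rel ` lists (X \<times> UNIV),
     mult = (\<lambda>A B. \<Union>a\<in>A. \<Union>b\<in>B. pres_class X Rel (a @ b)),
     one = pres_class X Rel []\<rparr>"

fun word_eval :: "('a, 'b) monoid_scheme \<Rightarrow> ('g \<Rightarrow> 'a) \<Rightarrow> 'g gword \<Rightarrow> 'a" where
  "word_eval H f [] = \<one>\<^bsub>H\<^esub>"
| "word_eval H f ((x, b) # w) = (if b then inv\<^bsub>H\<^esub> (f x) else f x) \<otimes>\<^bsub>H\<^esub> word_eval H f w"

text \<open>The homomorphism from a presented group to \<open>H\<close> determined by the images \<open>f\<close> of the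
  generators. The choice of the representative is irrelevant whenever \<open>f\<close> respects the relations,
  see \<open>pres_hom_class\<close> below.\<close>

definition pres_hom :: "('a, 'b) monoid_scheme \<Rightarrow> ('g \<Rightarrow> 'a) \<Rightarrow> 'g gword set \<Rightarrow> 'a" where
  "pres_hom H f A = word_eval H f (SOME w. w \<in> A)"

lemma pres_cong_words:
  assumes "pres_cong X Rel u v" and "Rel \<subseteq> lists (X \<times> UNIV) \<times> lists (X \<times> UNIV)"
  shows "u \<in> lists (X \<times> UNIV) \<and> v \<in> lists (X \<times> UNIV)"
  using assms(1)
proof (induction rule: pres_cong.induct)
  case (pc_rel u v)
  then show ?case using assms(2) by blast
qed simp_all

lemma pres_class_eq:
  assumes "pres_cong X Rel u v"
  shows "pres_class X Rel u = pres_class X Rel v"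
proof -
  have "pres_cong X Rel u w \<longleftrightarrow> pres_cong X Rel v w" for w
    using pc_trans[OF assms, of w] pc_trans[OF pc_sym[OF assms], of w] by (rule iffI[rotated])
  then show ?thesis unfolding pres_class_def by (rule Collect_cong)
qed

lemma pres_class_mult:
  assumes "u \<in> lists (X \<times> UNIV)" "v \<in> lists (X \<times> UNIV)"
  shows "pres_class X Rel u \<otimes>\<^bsub>presented_group X Rel\<^esub> pres_class X Rel v = pres_class X Rel (u @ v)"
proof -
  let ?A = "pres_class X Rel u" and ?B = "pres_class X Rel v"
  have c: "pres_class X Rel (a @ b) = pres_class X Rel (u @ v)" if "a \<in> ?A" "b \<in> ?B" for a b
  proof -
    have "pres_cong X Rel u a" "pres_cong X Rel v b" using that unfolding pres_class_def by blast+
    then show ?thesis by (rule pres_class_eq[OF pc_append[OF pc_sym pc_sym]])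
  qed
  have "(\<Union>a\<in>?A. \<Union>b\<in>?B. pres_class X Rel (a @ b)) = (\<Union>a\<in>?A. \<Union>b\<in>?B. pres_class X Rel (u @ v))"
    by (rule SUP_cong[OF refl], rule SUP_cong[OF refl], rule c)
  also have "\<dots> = pres_class X Rel (u @ v)"
  proof -
    have "u \<in> ?A" "v \<in> ?B" using assms by (simp_all add: pres_class_def pc_refl)
    then have "?A \<noteq> {}" "?B \<noteq> {}" by blast+
    then show ?thesis by simp
  qed
  finally show ?thesis unfolding presented_group_def monoid.simps .
qed

definition inv_word :: "'g gword \<Rightarrow> 'g gword" where
  "inv_word w = rev (map (\<lambda>(x, b). (x, \<not> b)) w)"

lemma inv_word_words: "w \<in> lists (X \<times> UNIV) \<Longrightarrow> inv_word w \<in> lists (X \<times> UNIV)"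
  unfolding inv_word_def by auto

lemma inv_word_cong:
  assumes "w \<in> lists (X \<times> UNIV)"
  shows "pres_cong X Rel (inv_word w @ w) []"
  using assms
proof (induction w rule: list.induct)
  case Nil
  then show ?case by (simp add: inv_word_def pc_refl)
next
  case (Cons l w)
  obtain x b where l: "l = (x, b)" by force
  have x: "x \<in> X" and w: "w \<in> lists (X \<times> UNIV)" using Cons.prems by (auto simp: l)
  have "pres_cong X Rel [(x, \<not> b), (x, b)] []"
    using pc_cancel[OF x, of Rel "\<not> b"] by simp
  from pc_append[OF this pc_refl[OF w]]
  have "pres_cong X Rel ([(x, \<not> b), (x, b)] @ w) ([] @ w)" .
  then have "pres_cong X Rel (inv_word w @ ([(x, \<not> b), (x, b)] @ w)) (inv_word w @ ([] @ w))"
    by (rule pc_append[OF pc_refl[OF inv_word_words[OF w]]])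
  then have "pres_cong X Rel (inv_word (l # w) @ l # w) (inv_word w @ w)"
    by (simp add: inv_word_def l)
  from pc_trans[OF this Cons.IH[OF w]] show ?case .
qed

lemma group_presented_group: "group (presented_group X Rel)"
proof (rule groupI)
  let ?G = "presented_group X Rel"
  have car: "carrier ?G = pres_class X Rel ` lists (X \<times> UNIV)"
    and one: "\<one>\<^bsub>?G\<^esub> = pres_class X Rel []"
    by (simp_all add: presented_group_def)
  show "\<one>\<^bsub>?G\<^esub> \<in> carrier ?G" unfolding car one by auto
  show "a \<otimes>\<^bsub>?G\<^esub> b \<in> carrier ?G" if "a \<in> carrier ?G" "b \<in> carrier ?G" for a b
  proof -
    from that obtain u v where
      "u \<in> lists (X \<times> UNIV)" "v \<in> lists (X \<times> UNIV)"
      "a = pres_class X Rel u" "b = pres_class X Rel v" unfolding car by blast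
    then show ?thesis unfolding car by (simp only: pres_class_mult) auto
  qed
  show "a \<otimes>\<^bsub>?G\<^esub> b \<otimes>\<^bsub>?G\<^esub> c = a \<otimes>\<^bsub>?G\<^esub> (b \<otimes>\<^bsub>?G\<^esub> c)"
    if "a \<in> carrier ?G" "b \<in> carrier ?G" "c \<in> carrier ?G" for a b c
  proof -
    from that obtain u v w where h:
      "u \<in> lists (X \<times> UNIV)" "v \<in> lists (X \<times> UNIV)" "w \<in> lists (X \<times> UNIV)"
      and e: "a = pres_class X Rel u" "b = pres_class X Rel v" "c = pres_class X Rel w"
      unfolding car by blast
    have "u @ v \<in> lists (X \<times> UNIV)" "v @ w \<in> lists (X \<times> UNIV)" using h by auto
    with h show ?thesis by (simp only: e pres_class_mult append_assoc)
  qed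
  show "\<one>\<^bsub>?G\<^esub> \<otimes>\<^bsub>?G\<^esub> a = a" if "a \<in> carrier ?G" for a
  proof -
    from that obtain u where h: "u \<in> lists (X \<times> UNIV)" and e: "a = pres_class X Rel u"
      unfolding car by blast
    show ?thesis using pres_class_mult[of "[]" X u Rel] h by (simp add: e one)
  qed
  show "\<exists>b\<in>carrier ?G. b \<otimes>\<^bsub>?G\<^esub> a = \<one>\<^bsub>?G\<^esub>" if "a \<in> carrier ?G" for a
  proof -
    from that obtain u where h: "u \<in> lists (X \<times> UNIV)" and e: "a = pres_class X Rel u"
      unfolding car by blast
    have "pres_class X Rel (inv_word u) \<otimes>\<^bsub>?G\<^esub> a = \<one>\<^bsub>?G\<^esub>"
      unfolding e one pres_class_mult[OF inv_word_words[OF h] h]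
      by (rule pres_class_eq[OF inv_word_cong[OF h]])
    then show ?thesis unfolding car using inv_word_words[OF h] by blast
  qed
qed

context
  fixes H :: "('a, 'b) monoid_scheme" and f :: "'g \<Rightarrow> 'a"
    and X :: "'g set" and Rel :: "('g gword \<times> 'g gword) set"
  assumes H: "group H"
    and f: "\<And>x. x \<in> X \<Longrightarrow> f x \<in> carrier H"
    and rels: "Rel \<subseteq> lists (X \<times> UNIV) \<times> lists (X \<times> UNIV)"
    and resp: "\<And>u v. (u, v) \<in> Rel \<Longrightarrow> word_eval H f u = word_eval H f v"
begin

interpretation group H by (rule H)

lemma word_eval_closed: "w \<in> lists (X \<times> UNIV) \<Longrightarrow> word_eval H f w \<in> carrier H"
  by (induction w) (auto simp: f)

lemma word_eval_append:
  "u \<in> lists (X \<times> UNIV) \<Longrightarrow> v \<in> lists (X \<times> UNIV)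
    \<Longrightarrow> word_eval H f (u @ v) = word_eval H f u \<otimes>\<^bsub>H\<^esub> word_eval H f v"
proof (induction u)
  case Nil
  then show ?case by (simp add: word_eval_closed)
next
  case (Cons l u)
  obtain x b where l: "l = (x, b)" by force
  show ?case using Cons by (auto simp: l f word_eval_closed m_assoc)
qed

lemma word_eval_cong: "pres_cong X Rel u v \<Longrightarrow> word_eval H f u = word_eval H f v"
proof (induction rule: pres_cong.induct)
  case (pc_append u u' v v')
  then show ?case
    using pres_cong_words[OF pc_append.hyps(1) rels] pres_cong_words[OF pc_append.hyps(2) rels]
    by (simp only: word_eval_append)
next
  case (pc_rel u v)
  then show ?case by (rule resp)
next
  case (pc_cancel x b)
  then show ?case by (simp add: f)
qed simp_all

lemma pres_hom_class:
  assumes w: "w \<in> lists (X \<times> UNIV)"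
  shows "pres_hom H f (pres_class X Rel w) = word_eval H f w"
proof -
  have "w \<in> pres_class X Rel w" using w by (simp add: pres_class_def pc_refl)
  then have "(SOME v. v \<in> pres_class X Rel w) \<in> pres_class X Rel w" by (rule someI)
  then have "pres_cong X Rel w (SOME v. v \<in> pres_class X Rel w)"
    unfolding pres_class_def by blast
  from word_eval_cong[OF this] show ?thesis by (simp add: pres_hom_def)
qed

lemma pres_hom_hom: "pres_hom H f \<in> hom (presented_group X Rel) H"
proof (rule homI)
  have car: "carrier (presented_group X Rel) = pres_class X Rel ` lists (X \<times> UNIV)"
    by (simp add: presented_group_def)
  fix a assume "a \<in> carrier (presented_group X Rel)"
  then obtain u where u: "u \<in> lists (X \<times> UNIV)" "a = pres_class X Rel u" unfolding car by blast
  then show "pres_hom H f a \<in> carrier H"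
    by (simp only: pres_hom_class word_eval_closed)
  fix b assume "b \<in> carrier (presented_group X Rel)"
  then obtain v where v: "v \<in> lists (X \<times> UNIV)" "b = pres_class X Rel v" unfolding car by blast
  have uv: "u @ v \<in> lists (X \<times> UNIV)" using u v by auto
  show "pres_hom H f (a \<otimes>\<^bsub>presented_group X Rel\<^esub> b) = pres_hom H f a \<otimes>\<^bsub>H\<^esub> pres_hom H f b"
    using u v uv by (simp only: pres_class_mult pres_hom_class word_eval_append)
qed

end


section \<open>The mixed doubles group\<close>

datatype md_gen = s_gen nat | r_gen nat

abbreviation s_let :: "nat \<Rightarrow> md_gen \<times> bool" where "s_let i \<equiv> (s_gen i, False)"
abbreviation r_let :: "nat \<Rightarrow> md_gen \<times> bool" where "r_let i \<equiv> (r_gen i, False)"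

definition md_gens :: "nat \<Rightarrow> md_gen set" where
  "md_gens n = {s_gen i | i. 1 \<le> i \<and> i < n} \<union> {r_gen i | i. 1 \<le> i \<and> i < n}"

text \<open>The condition \<open>\<bar>i - j\<bar> > 1\<close> is expressed as \<open>i + 1 < j \<or> j + 1 < i\<close>.\<close>

definition md_rels :: "nat \<Rightarrow> (md_gen gword \<times> md_gen gword) set" where
  "md_rels n =
     {([r_let i, r_let (i+1), r_let i], [r_let (i+1), r_let i, r_let (i+1)]) | i. 1 \<le> i \<and> i + 1 < n}
   \<union> {([r_let i, r_let (i+1), s_let i], [s_let (i+1), r_let i, r_let (i+1)]) | i. 1 \<le> i \<and> i + 1 < n}
   \<union> {([r_let i, s_let (i+1), s_let i], [s_let (i+1), s_let i, r_let (i+1)]) | i. 1 \<le> i \<and> i + 1 < n}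
   \<union> {([s_let i, s_let (i+1), s_let i], [s_let (i+1), s_let i, s_let (i+1)]) | i. 1 \<le> i \<and> i + 1 < n}
   \<union> {([s_let i, s_let i], []) | i. 1 \<le> i \<and> i < n}
   \<union> {([r_let i, r_let i], []) | i. 1 \<le> i \<and> i < n}
   \<union> {([r_let i, r_let j], [r_let j, r_let i]) | i j.
        1 \<le> i \<and> i < n \<and> 1 \<le> j \<and> j < n \<and> (i + 1 < j \<or> j + 1 < i)}
   \<union> {([s_let i, s_let j], [s_let j, s_let i]) | i j.
        1 \<le> i \<and> i < n \<and> 1 \<le> j \<and> j < n \<and> (i + 1 < j \<or> j + 1 < i)}
   \<union> {([r_let i, s_let j], [s_let j, r_let i]) | i j.
        1 \<le> i \<and> i < n \<and> 1 \<le> j \<and> j < n \<and> (i + 1 < j \<or> j + 1 < i)}"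

definition MD :: "nat \<Rightarrow> md_gen gword set monoid" where
  "MD n = presented_group (md_gens n) (md_rels n)"

definition md_s :: "nat \<Rightarrow> nat \<Rightarrow> md_gen gword set" where
  "md_s n i = pres_class (md_gens n) (md_rels n) [s_let i]"

definition md_r :: "nat \<Rightarrow> nat \<Rightarrow> md_gen gword set" where
  "md_r n i = pres_class (md_gens n) (md_rels n) [r_let i]"


section \<open>Matrix representations and indecomposability\<close>

definition GL :: "nat \<Rightarrow> complex mat monoid" where
  "GL d = units_of (ring_mat TYPE(complex) d ())"

definition representation :: "('g, 'b) monoid_scheme \<Rightarrow> nat \<Rightarrow> ('g \<Rightarrow> complex mat) \<Rightarrow> bool" where
  "representation G d \<rho> \<longleftrightarrow> group G \<and> \<rho> \<in> hom G (GL d)"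

definition subrepresentation ::
    "('g, 'b) monoid_scheme \<Rightarrow> nat \<Rightarrow> ('g \<Rightarrow> complex mat) \<Rightarrow> complex vec set \<Rightarrow> bool" where
  "subrepresentation G d \<rho> W \<longleftrightarrow>
     subspace class_ring W (module_vec TYPE(complex) d) \<and>
     (\<forall>g\<in>carrier G. \<forall>w\<in>W. \<rho> g *\<^sub>v w \<in> W)"

definition indecomposable :: "('g, 'b) monoid_scheme \<Rightarrow> nat \<Rightarrow> ('g \<Rightarrow> complex mat) \<Rightarrow> bool" where
  "indecomposable G d \<rho> \<longleftrightarrow>
     representation G d \<rho> \<and>
     (carrier_vec d :: complex vec set) \<noteq> {0\<^sub>v d} \<and>
     \<not> (\<exists>W1 W2. subrepresentation G d \<rho> W1 \<and> subrepresentation G d \<rho> W2 \<and>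
          W1 \<noteq> {0\<^sub>v d} \<and> W2 \<noteq> {0\<^sub>v d} \<and> W1 \<inter> W2 = {0\<^sub>v d} \<and>
          module.submodule_sum (module_vec TYPE(complex) d) W1 W2 = carrier_vec d)"


section \<open>Kronecker products\<close>

definition kron :: "'a :: semiring_1 mat \<Rightarrow> 'a mat \<Rightarrow> 'a mat" (infixr "\<otimes>\<^sub>K" 73) where
  "A \<otimes>\<^sub>K B = mat (dim_row A * dim_row B) (dim_col A * dim_col B)
     (\<lambda>(i, j). A $$ (i div dim_row B, j div dim_col B) * B $$ (i mod dim_row B, j mod dim_col B))"

fun kron_power :: "'a :: semiring_1 mat \<Rightarrow> nat \<Rightarrow> 'a mat" where
  "kron_power A 0 = 1\<^sub>m 1"
| "kron_power A (Suc k) = A \<otimes>\<^sub>K kron_power A k"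

text \<open>\<open>(\<complex>\<^sup>2)\<^sup>\<otimes>\<^sup>n\<close> is identified with \<open>\<complex>\<^bsup>2^n\<^esup>\<close> through the lexicographically ordered product
  basis, as is implicit in writing \<open>R\<close> and \<open>S\<close> as \<open>4 \<times> 4\<close> matrices. Matrices act on column
  vectors.\<close>

definition site_op :: "nat \<Rightarrow> nat \<Rightarrow> complex mat \<Rightarrow> complex mat" where
  "site_op n i A = kron_power (1\<^sub>m 2) (i - 1) \<otimes>\<^sub>K A \<otimes>\<^sub>K kron_power (1\<^sub>m 2) (n - i - 1)"

fun md_gen_image :: "nat \<Rightarrow> complex mat \<Rightarrow> complex mat \<Rightarrow> md_gen \<Rightarrow> complex mat" where
  "md_gen_image n R S (r_gen i) = site_op n i R"
| "md_gen_image n R S (s_gen i) = site_op n i S"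

definition md_rep :: "nat \<Rightarrow> complex mat \<Rightarrow> complex mat \<Rightarrow> md_gen gword set \<Rightarrow> complex mat" where
  "md_rep n R S = pres_hom (GL (2 ^ n)) (md_gen_image n R S)"

definition glue_mat :: "complex \<Rightarrow> complex mat" where
  "glue_mat c = mat_of_rows_list 4
     [[1, c, - c, - (c ^ 2)],
      [0, 0,   1,       c],
      [0, 1,   0,     - c],
      [0, 0,   0,       1]]"


section \<open>The f-glue matrices define a representation of the mixed doubles group\<close>

lemma kron_dims [simp]:
  "dim_row (A \<otimes>\<^sub>K B) = dim_row A * dim_row B" "dim_col (A \<otimes>\<^sub>K B) = dim_col A * dim_col B"
  by (simp_all add: kron_def)

lemma kron_carrier:
  "A \<in> carrier_mat a b \<Longrightarrow> B \<in> carrier_mat c d \<Longrightarrow> A \<otimes>\<^sub>K B \<in> carrier_mat (a * c) (b * d)"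
  unfolding carrier_mat_def by simp

lemma sum_div_mod:
  fixes g :: "nat \<Rightarrow> nat \<Rightarrow> 'a :: comm_monoid_add"
  shows "(\<Sum>k<n * m. g (k div m) (k mod m)) = (\<Sum>a<n. \<Sum>b<m. g a b)"
proof -
  have "(\<Sum>k<n * m. g (k div m) (k mod m)) = (\<Sum>a<n. \<Sum>k=a*m..<a*m+m. g (k div m) (k mod m))"
    by (simp add: sum.nat_group)
  also have "\<dots> = (\<Sum>a<n. \<Sum>b<m. g a b)"
  proof (rule sum.cong[OF refl])
    fix a
    have "(\<Sum>k=a*m..<a*m+m. g (k div m) (k mod m))
        = (\<Sum>b=0..<m. g ((b + a*m) div m) ((b + a*m) mod m))"
      using sum.shift_bounds_nat_ivl[of "\<lambda>k. g (k div m) (k mod m)" 0 "a*m" m]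
      by (simp add: add.commute)
    also have "\<dots> = (\<Sum>b=0..<m. g a b)" by (intro sum.cong refl) simp
    finally show "(\<Sum>k=a*m..<a*m+m. g (k div m) (k mod m)) = (\<Sum>b<m. g a b)"
      by (simp add: atLeast0LessThan)
  qed
  finally show ?thesis .
qed

lemma div_less_mult: "(i :: nat) < a * b \<Longrightarrow> i div b < a"
  by (simp add: less_mult_imp_div_less)

lemma mod_less_mult: "(i :: nat) < a * b \<Longrightarrow> i mod b < b"
  by (cases "b = 0") auto

lemma kron_index:
  assumes "A \<in> carrier_mat a b" "B \<in> carrier_mat c d" "i < a * c" "j < b * d"
  shows "(A \<otimes>\<^sub>K B) $$ (i, j) = A $$ (i div c, j div d) * B $$ (i mod c, j mod d)"
  using assms by (auto simp: kron_def)

lemma kron_mult: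
  fixes A B C D :: "'a :: comm_semiring_1 mat"
  assumes A: "A \<in> carrier_mat a b" and C: "C \<in> carrier_mat b c"
    and B: "B \<in> carrier_mat x y" and D: "D \<in> carrier_mat y z"
  shows "(A \<otimes>\<^sub>K B) * (C \<otimes>\<^sub>K D) = (A * C) \<otimes>\<^sub>K (B * D)"
proof (rule eq_matI)
  fix i j assume "i < dim_row ((A * C) \<otimes>\<^sub>K (B * D))" "j < dim_col ((A * C) \<otimes>\<^sub>K (B * D))"
  then have i: "i < a * x" and j: "j < c * z" using A B C D by auto
  have AC: "A * C \<in> carrier_mat a c" and BD: "B * D \<in> carrier_mat x z" using A B C D by auto
  have "((A \<otimes>\<^sub>K B) * (C \<otimes>\<^sub>K D)) $$ (i, j) = (\<Sum>k<b * y. (A \<otimes>\<^sub>K B) $$ (i, k) * (C \<otimes>\<^sub>K D) $$ (k, j))"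
    using A B C D i j by (auto simp: scalar_prod_def atLeast0LessThan)
  also have "\<dots> = (\<Sum>k<b * y. A $$ (i div x, k div y) * C $$ (k div y, j div z)
                           * (B $$ (i mod x, k mod y) * D $$ (k mod y, j mod z)))"
    using i j by (intro sum.cong refl)
      (simp add: kron_index[OF A B] kron_index[OF C D] ac_simps)
  also have "\<dots> = (\<Sum>k<b. \<Sum>l<y. A $$ (i div x, k) * C $$ (k, j div z)
                           * (B $$ (i mod x, l) * D $$ (l, j mod z)))"
    by (rule sum_div_mod)
  also have "\<dots> = (\<Sum>k<b. A $$ (i div x, k) * C $$ (k, j div z))
                * (\<Sum>l<y. B $$ (i mod x, l) * D $$ (l, j mod z))"
    by (simp add: sum_product)
  also have "\<dots> = (A * C) $$ (i div x, j div z) * (B * D) $$ (i mod x, j mod z)"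
    using A B C D div_less_mult[OF i] mod_less_mult[OF i] div_less_mult[OF j] mod_less_mult[OF j]
    by (auto simp: scalar_prod_def atLeast0LessThan)
  also have "\<dots> = ((A * C) \<otimes>\<^sub>K (B * D)) $$ (i, j)"
    by (rule kron_index[OF AC BD i j, symmetric])
  finally show "((A \<otimes>\<^sub>K B) * (C \<otimes>\<^sub>K D)) $$ (i, j) = ((A * C) \<otimes>\<^sub>K (B * D)) $$ (i, j)" .
qed (use A B C D in auto)

lemma kron_assoc: "(A \<otimes>\<^sub>K B) \<otimes>\<^sub>K C = A \<otimes>\<^sub>K (B \<otimes>\<^sub>K C)"
proof (rule eq_matI)
  fix i j
  assume "i < dim_row (A \<otimes>\<^sub>K (B \<otimes>\<^sub>K C))" "j < dim_col (A \<otimes>\<^sub>K (B \<otimes>\<^sub>K C))"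
  then have i: "i < dim_row A * (dim_row B * dim_row C)" and j: "j < dim_col A * (dim_col B * dim_col C)"
    by auto
  have i': "i < (dim_row A * dim_row B) * dim_row C" and j': "j < (dim_col A * dim_col B) * dim_col C"
    using i j by (simp_all add: ac_simps)
  note b = div_less_mult[OF i'] div_less_mult[OF j'] mod_less_mult[OF i] mod_less_mult[OF j]
  have r: "k mod (m * l) div l = k div l mod m" "k mod (m * l) mod l = k mod l"
    for k m l :: nat
    using mod_mult2_eq[of k l m] by (cases "l = 0"; simp add: mult.commute mod_mod_cancel)+
  have q: "k div (m * l) = k div l div m" for k m l :: nat
    using div_mult2_eq[of k l m] by (simp add: mult.commute)
  show "((A \<otimes>\<^sub>K B) \<otimes>\<^sub>K C) $$ (i, j) = (A \<otimes>\<^sub>K (B \<otimes>\<^sub>K C)) $$ (i, j)"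
    using i j i' j' b by (simp add: kron_def r q mult.assoc)
qed (simp_all add: mult.assoc)

lemma kron_one: "1\<^sub>m a \<otimes>\<^sub>K 1\<^sub>m b = 1\<^sub>m (a * b)"
proof (rule eq_matI)
  fix i j assume "i < dim_row (1\<^sub>m (a * b))" "j < dim_col (1\<^sub>m (a * b))"
  then have i: "i < a * b" and j: "j < a * b" by auto
  have "i = j \<longleftrightarrow> i div b = j div b \<and> i mod b = j mod b"
    by (metis div_mult_mod_eq)
  then show "(1\<^sub>m a \<otimes>\<^sub>K 1\<^sub>m b) $$ (i, j) = 1\<^sub>m (a * b) $$ (i, j)"
    using i j div_less_mult[OF i] mod_less_mult[OF i] div_less_mult[OF j] mod_less_mult[OF j]
    by (auto simp: kron_def)
qed auto

lemma kron_power_one: "kron_power (1\<^sub>m 2) k = 1\<^sub>m (2 ^ k)"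
  by (induction k) (auto simp: kron_one)

lemma site_op_alt: "site_op n i A = 1\<^sub>m (2 ^ (i - 1)) \<otimes>\<^sub>K A \<otimes>\<^sub>K 1\<^sub>m (2 ^ (n - i - 1))"
  unfolding site_op_def kron_power_one ..

lemma kron_pad_mult:
  fixes A B :: "'a :: comm_semiring_1 mat"
  assumes "A \<in> carrier_mat m m" "B \<in> carrier_mat m m"
  shows "(1\<^sub>m a \<otimes>\<^sub>K A \<otimes>\<^sub>K 1\<^sub>m b) * (1\<^sub>m a \<otimes>\<^sub>K B \<otimes>\<^sub>K 1\<^sub>m b) = 1\<^sub>m a \<otimes>\<^sub>K (A * B) \<otimes>\<^sub>K 1\<^sub>m b"
proof -
  have "(1\<^sub>m a \<otimes>\<^sub>K A \<otimes>\<^sub>K 1\<^sub>m b) * (1\<^sub>m a \<otimes>\<^sub>K B \<otimes>\<^sub>K 1\<^sub>m b)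
      = (1\<^sub>m a * 1\<^sub>m a) \<otimes>\<^sub>K ((A \<otimes>\<^sub>K 1\<^sub>m b) * (B \<otimes>\<^sub>K 1\<^sub>m b))"
    by (rule kron_mult[OF one_carrier_mat one_carrier_mat
          kron_carrier[OF assms(1) one_carrier_mat] kron_carrier[OF assms(2) one_carrier_mat]])
  also have "(A \<otimes>\<^sub>K 1\<^sub>m b) * (B \<otimes>\<^sub>K 1\<^sub>m b) = (A * B) \<otimes>\<^sub>K (1\<^sub>m b * 1\<^sub>m b)"
    by (rule kron_mult[OF assms one_carrier_mat one_carrier_mat])
  finally show ?thesis by simp
qed

lemma glue_carrier: "glue_mat c \<in> carrier_mat 4 4"
  by (auto simp: glue_mat_def mat_of_rows_list_def)

lemma mat_as_rows: "mat n m f = mat_of_rows_list m (map (\<lambda>i. map (\<lambda>j. f (i, j)) [0..<m]) [0..<n])"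
  by (rule eq_matI) (auto simp: mat_of_rows_list_def)

lemma mult_rows:
  assumes "length ss = m"
  shows "mat_of_rows_list m rs * mat_of_rows_list l ss
    = mat_of_rows_list l (map (\<lambda>r. map (\<lambda>j. \<Sum>k\<leftarrow>[0..<m]. r ! k * ss ! k ! j) [0..<l]) rs)"
  by (rule eq_matI)
    (use assms in \<open>auto simp: mat_of_rows_list_def scalar_prod_def interv_sum_list_conv_sum_set_nat\<close>)

lemma upt8: "[0..<8] = [0, 1, 2, 3, 4, 5, 6, 7 :: nat]"
  by (simp add: upt_rec)

definition glue_left :: "complex \<Rightarrow> complex mat" where
  "glue_left c = mat_of_rows_list 8
    [[1, 0, c, 0, -c, 0, -(c^2), 0],
     [0, 1, 0, c, 0, -c, 0, -(c^2)],
     [0, 0, 0, 0, 1, 0, c, 0],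
     [0, 0, 0, 0, 0, 1, 0, c],
     [0, 0, 1, 0, 0, 0, -c, 0],
     [0, 0, 0, 1, 0, 0, 0, -c],
     [0, 0, 0, 0, 0, 0, 1, 0],
     [0, 0, 0, 0, 0, 0, 0, 1]]"

definition glue_right :: "complex \<Rightarrow> complex mat" where
  "glue_right c = mat_of_rows_list 8
    [[1, c, -c, -(c^2), 0, 0, 0, 0],
     [0, 0, 1, c, 0, 0, 0, 0],
     [0, 1, 0, -c, 0, 0, 0, 0],
     [0, 0, 0, 1, 0, 0, 0, 0],
     [0, 0, 0, 0, 1, c, -c, -(c^2)],
     [0, 0, 0, 0, 0, 0, 1, c],
     [0, 0, 0, 0, 0, 1, 0, -c],
     [0, 0, 0, 0, 0, 0, 0, 1]]"

lemma rows_entry: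
  "i < length rs \<Longrightarrow> j < m \<Longrightarrow> mat_of_rows_list m rs $$ (i, j) = rs ! i ! j"
  "dim_row (mat_of_rows_list m rs) = length rs" "dim_col (mat_of_rows_list m rs) = m"
  by (simp_all add: mat_of_rows_list_def)

lemma glue_left: "glue_mat c \<otimes>\<^sub>K 1\<^sub>m 2 = glue_left c"
  by (simp add: kron_def glue_left_def glue_mat_def rows_entry mat_as_rows[of 8] upt8)

lemma glue_right: "1\<^sub>m 2 \<otimes>\<^sub>K glue_mat c = glue_right c"
  by (simp add: kron_def glue_right_def glue_mat_def rows_entry mat_as_rows[of 8] upt8)

lemma glue_braid:
  "glue_left a * glue_right b * glue_left c = glue_right c * glue_left b * glue_right a"
  unfolding glue_left_def glue_right_def
  apply (simp add: mult_rows upt8)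
  apply (rule arg_cong[where f = "mat_of_rows_list 8"])
  apply (simp add: power2_eq_square)
  apply (auto simp: algebra_simps)
  done

lemma upt4: "[0..<4] = [0, 1, 2, 3 :: nat]"
  by (simp add: upt_rec)

lemma glue_square: "glue_mat c * glue_mat c = 1\<^sub>m 4"
  unfolding one_mat_def mat_as_rows[of 4]
  by (simp add: glue_mat_def mult_rows upt4 algebra_simps power2_eq_square)

lemma site_carrier:
  assumes "A \<in> carrier_mat 4 4" "1 \<le> i" "i < n"
  shows "site_op n i A \<in> carrier_mat (2 ^ n) (2 ^ n)"
proof -
  obtain a b where n: "n = a + b + 2" and i: "i = a + 1"
    using assms(2,3) that[of "i - 1" "n - i - 1"] by simp
  have "2 ^ n = 2 ^ a * (4 * 2 ^ b :: nat)" by (simp add: n power_add)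
  moreover have "site_op n i A = 1\<^sub>m (2 ^ a) \<otimes>\<^sub>K A \<otimes>\<^sub>K 1\<^sub>m (2 ^ b)"
    by (simp add: site_op_alt n i)
  ultimately show ?thesis
    by (simp only:) (intro kron_carrier one_carrier_mat assms(1))
qed

lemma site_square:
  assumes "1 \<le> i" "i < n"
  shows "site_op n i (glue_mat c) * site_op n i (glue_mat c) = 1\<^sub>m (2 ^ n)"
proof -
  obtain a b where n: "n = a + b + 2" and i: "i = a + 1"
    using assms that[of "i - 1" "n - i - 1"] by simp
  have "2 ^ n = 2 ^ a * (4 * 2 ^ b :: nat)" by (simp add: n power_add)
  moreover have "site_op n i (glue_mat c) = 1\<^sub>m (2 ^ a) \<otimes>\<^sub>K glue_mat c \<otimes>\<^sub>K 1\<^sub>m (2 ^ b)"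
    by (simp add: site_op_alt n i)
  ultimately show ?thesis
    by (simp only: kron_pad_mult[OF glue_carrier glue_carrier] glue_square kron_one)
qed

lemma site_braid:
  assumes "1 \<le> i" "i + 1 < n"
  shows "site_op n i (glue_mat x) * (site_op n (i + 1) (glue_mat y) * site_op n i (glue_mat z))
    = site_op n (i + 1) (glue_mat z) * (site_op n i (glue_mat y) * site_op n (i + 1) (glue_mat x))"
proof -
  obtain a b where n: "n = a + b + 3" and i: "i = a + 1"
    using assms that[of "i - 1" "n - i - 2"] by simp
  let ?p = "\<lambda>M. 1\<^sub>m (2 ^ a) \<otimes>\<^sub>K M \<otimes>\<^sub>K 1\<^sub>m (2 ^ b) :: complex mat"
  have l: "site_op n i (glue_mat c) = ?p (glue_left c)" for c
    by (simp add: site_op_alt n i glue_left[symmetric] kron_assoc kron_one)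
  have "1\<^sub>m (2 ^ Suc a) = 1\<^sub>m (2 ^ a) \<otimes>\<^sub>K (1\<^sub>m 2 :: complex mat)" by (simp add: kron_one mult.commute)
  then have r: "site_op n (i + 1) (glue_mat c) = ?p (glue_right c)" for c
    by (simp add: site_op_alt n i glue_right[symmetric] kron_assoc)
  have c: "glue_left c \<in> carrier_mat 8 8" "glue_right c \<in> carrier_mat 8 8" for c
    by (auto simp: glue_left_def glue_right_def mat_of_rows_list_def)
  have assoc: "M * (N * K) = M * N * K"
    if "M \<in> carrier_mat 8 8" "N \<in> carrier_mat 8 8" "K \<in> carrier_mat 8 8" for M N K :: "complex mat"
    using assoc_mult_mat[OF that] by simp
  have m: "?p M * (?p N * ?p K) = ?p (M * N * K)"
    if "M \<in> carrier_mat 8 8" "N \<in> carrier_mat 8 8" "K \<in> carrier_mat 8 8" for M N K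
    using kron_pad_mult[OF that(2,3)] kron_pad_mult[OF that(1) mult_carrier_mat[OF that(2,3)]]
    by (simp add: assoc[OF that])
  show ?thesis unfolding l r by (simp add: m c glue_braid)
qed

lemma site_commute:
  assumes "1 \<le> i" "i + 1 < j" "j < n" and A: "A \<in> carrier_mat 4 4" and B: "B \<in> carrier_mat 4 4"
  shows "site_op n i A * site_op n j B = site_op n j B * site_op n i A"
proof -
  obtain a where i: "i = a + 1" using assms(1) that[of "i - 1"] by simp
  obtain k where j: "j = i + k + 2" using assms(2) less_iff_Suc_add[of "i + 1" j] by auto
  obtain b where n: "n = j + b + 1" using assms(3) less_iff_Suc_add[of j n] by auto
  let ?p = "\<lambda>M. 1\<^sub>m (2 ^ a) \<otimes>\<^sub>K M \<otimes>\<^sub>K 1\<^sub>m (2 ^ b) :: complex mat"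
  let ?M = "A \<otimes>\<^sub>K 1\<^sub>m (2 ^ k * 4)" and ?N = "1\<^sub>m 4 \<otimes>\<^sub>K (1\<^sub>m (2 ^ k) \<otimes>\<^sub>K B)"
  have kB: "1\<^sub>m (2 ^ k) \<otimes>\<^sub>K B \<in> carrier_mat (2 ^ k * 4) (2 ^ k * 4)"
    by (rule kron_carrier[OF one_carrier_mat B])
  have "1\<^sub>m (2 ^ k * 4) \<otimes>\<^sub>K 1\<^sub>m (2 ^ b) = (1\<^sub>m (2 ^ (n - i - 1)) :: complex mat)"
    by (simp add: kron_one n j power_add mult_ac)
  then have l: "site_op n i A = ?p ?M"
    by (simp add: site_op_alt kron_assoc i)
  have "1\<^sub>m (2 ^ (j - 1)) = 1\<^sub>m (2 ^ a) \<otimes>\<^sub>K 1\<^sub>m 4 \<otimes>\<^sub>K (1\<^sub>m (2 ^ k) :: complex mat)"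
    by (simp add: kron_one j i power_add mult_ac)
  then have r: "site_op n j B = ?p ?N"
    by (simp add: site_op_alt kron_assoc n)
  have M: "?M \<in> carrier_mat (4 * (2 ^ k * 4)) (4 * (2 ^ k * 4))"
    by (rule kron_carrier[OF A one_carrier_mat])
  have N: "?N \<in> carrier_mat (4 * (2 ^ k * 4)) (4 * (2 ^ k * 4))"
    by (rule kron_carrier[OF one_carrier_mat kB])
  have "?M * ?N = ?N * ?M"
    unfolding kron_mult[OF A one_carrier_mat one_carrier_mat kB]
      kron_mult[OF one_carrier_mat A kB one_carrier_mat]
    by (simp only: left_mult_one_mat[OF A] right_mult_one_mat[OF A]
      left_mult_one_mat[OF kB] right_mult_one_mat[OF kB])
  then show ?thesis
    unfolding l r by (simp add: kron_pad_mult[OF M N] kron_pad_mult[OF N M])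
qed

lemma GL_simps:
  "\<one>\<^bsub>GL d\<^esub> = 1\<^sub>m d" "A \<otimes>\<^bsub>GL d\<^esub> B = A * B"
  by (simp_all add: GL_def units_of_def ring_mat_def)

lemma group_GL: "group (GL d)"
proof -
  interpret R: ring "ring_mat TYPE(complex) d ()" by (rule ring_mat)
  show ?thesis unfolding GL_def by (rule R.units_group)
qed

lemma in_GL: "A \<in> carrier_mat d d \<Longrightarrow> A * A = 1\<^sub>m d \<Longrightarrow> A \<in> carrier (GL d)"
  by (auto simp: GL_def units_of_def Units_def ring_mat_simps)

lemma md_gens_iff:
  "s_gen i \<in> md_gens n \<longleftrightarrow> 1 \<le> i \<and> i < n" "r_gen i \<in> md_gens n \<longleftrightarrow> 1 \<le> i \<and> i < n"
  by (auto simp: md_gens_def)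

lemma md_rels_words: "md_rels n \<subseteq> lists (md_gens n \<times> UNIV) \<times> lists (md_gens n \<times> UNIV)"
  unfolding md_rels_def by (auto simp: md_gens_iff)

lemma md_gen_image_closed:
  "x \<in> md_gens n \<Longrightarrow> md_gen_image n (glue_mat q) (glue_mat p) x \<in> carrier (GL (2 ^ n))"
  by (auto simp: md_gens_def intro!: in_GL site_carrier glue_carrier site_square)

lemma md_rels_respected:
  assumes "(u, v) \<in> md_rels n"
  shows "word_eval (GL (2 ^ n)) (md_gen_image n (glue_mat q) (glue_mat p)) u
       = word_eval (GL (2 ^ n)) (md_gen_image n (glue_mat q) (glue_mat p)) v"
proof -
  let ?N = "(2 :: nat) ^ n"
  have one: "site_op n i (glue_mat c) * 1\<^sub>m ?N = site_op n i (glue_mat c)" if "1 \<le> i" "i < n" for i c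
    by (rule right_mult_one_mat[OF site_carrier[OF glue_carrier that]])
  have far: "site_op n i (glue_mat c) * site_op n j (glue_mat d)
      = site_op n j (glue_mat d) * site_op n i (glue_mat c)"
    if "1 \<le> i" "i < n" "1 \<le> j" "j < n" "i + 1 < j \<or> j + 1 < i" for i j c d
    using that site_commute[of i j n "glue_mat c" "glue_mat d"]
      site_commute[of j i n "glue_mat d" "glue_mat c"] by (auto simp: glue_carrier)
  from assms show ?thesis
    unfolding md_rels_def
    by (elim UnE CollectE exE conjE)
      (auto simp: GL_simps one site_braid[simplified] site_square intro: far)
qed

text \<open>Indecomposability for \<open>q \<noteq> p\<close> can only hold from \<open>n = 3\<close> on: the group \<open>MD 1\<close> is trivial and acts
  on \<open>\<complex>\<^sup>2\<close>, and for \<open>n = 2\<close> the subspaces spanned by \<open>e\<^sub>2 + e\<^sub>3\<close> and by \<open>e\<^sub>1, e\<^sub>2 - e\<^sub>3, e\<^sub>4\<close> are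
  complementary and invariant under every \<open>glue_mat c\<close>.\<close>

lemma md_rep_representation: "representation (MD n) (2 ^ n) (md_rep n (glue_mat q) (glue_mat p))"
  unfolding representation_def MD_def md_rep_def
  using group_presented_group
    pres_hom_hom[OF group_GL md_gen_image_closed md_rels_words md_rels_respected] by blast

lemma md_rep_gens:
  assumes "1 \<le> i" "i < n"
  shows "md_rep n (glue_mat q) (glue_mat p) (md_r n i) = site_op n i (glue_mat q)"
    and "md_rep n (glue_mat q) (glue_mat p) (md_s n i) = site_op n i (glue_mat p)"
proof -
  let ?f = "md_gen_image n (glue_mat q) (glue_mat p)"
  have h: "pres_hom (GL (2 ^ n)) ?f (pres_class (md_gens n) (md_rels n) w) = word_eval (GL (2 ^ n)) ?f w"
    if "w \<in> lists (md_gens n \<times> UNIV)" for w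
    by (rule pres_hom_class[OF group_GL md_gen_image_closed md_rels_words md_rels_respected that])
  have w: "[r_let i] \<in> lists (md_gens n \<times> UNIV)" "[s_let i] \<in> lists (md_gens n \<times> UNIV)"
    using assms by (auto simp: md_gens_iff)
  have "site_op n i (glue_mat c) * 1\<^sub>m (2 ^ n) = site_op n i (glue_mat c)" for c
    by (rule right_mult_one_mat[OF site_carrier[OF glue_carrier assms]])
  then show "md_rep n (glue_mat q) (glue_mat p) (md_r n i) = site_op n i (glue_mat q)"
    and "md_rep n (glue_mat q) (glue_mat p) (md_s n i) = site_op n i (glue_mat p)"
    unfolding md_rep_def md_r_def md_s_def h[OF w(1)] h[OF w(2)] by (simp_all add: GL_simps)
qed

end

theory Submission
  imports Defs "HOL-Library.Nat_Bijection"
begin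

text \<open>Let \<open>N\<^sub>b\<close> send \<open>e\<^sub>2\<close> to \<open>e\<^sub>1\<close> and \<open>e\<^sub>1\<close> to \<open>0\<close> in the tensor factor \<open>b\<close>. For \<open>q \<noteq> p\<close>, the logarithm of
  \<open>s\<^sub>i r\<^sub>i\<close> is a nonzero multiple of the difference of the two operators \<open>N\<^sub>b\<close> at site \<open>i\<close>, so every
  subrepresentation is stable under all \<open>N\<^sub>b - N\<^sub>c\<close>. As \<open>N\<^sub>b\<^sup>2 = 0\<close>, it is then stable under
  \<open>N\<^sub>b N\<^sub>c = - (N\<^sub>b - N\<^sub>c)\<^sup>2 / 2\<close> and, multiplying by further differences, under every squarefree monomial in
  the \<open>N\<^sub>b\<close> of degree at least \<open>2\<close>. If \<open>\<complex>\<^bsup>2^n\<^esup>\<close> is the direct sum of \<open>W\<close> and \<open>W'\<close>, one of them, say \<open>W\<close>,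
  has a vector with nonzero coefficient at \<open>e\<^sub>2 \<otimes> \<dots> \<otimes> e\<^sub>2\<close>; applying these monomials shows that \<open>W\<close>
  contains all tensors with at least two factors \<open>e\<^sub>1\<close>. The monomials map \<open>W'\<close> into \<open>W \<inter> W' = 0\<close>, so
  vectors of \<open>W'\<close> involve only tensors with at most one factor \<open>e\<^sub>2\<close>. For \<open>n \<ge> 3\<close> those lie in \<open>W\<close>,
  whence \<open>W' = 0\<close>.

  For \<open>q = p\<close> the group fixes a product vector whose coefficient at \<open>e\<^sub>2 \<otimes> \<dots> \<otimes> e\<^sub>2\<close> is \<open>1\<close>, and the
  hyperplane where this coefficient vanishes is an invariant complement.\<close>

section \<open>Spaces stable under differences of lowering operators\<close>

text \<open>In coordinates, this is the product of the \<open>N\<^sub>b\<close> for \<open>b\<close>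
  in \<open>J\<close>: an index set collects the factors equal to \<open>e\<^sub>2\<close>, so the
  image at \<open>I\<close> comes from \<open>I \<union> J\<close>.\<close>

definition lower :: "nat set \<Rightarrow> (nat set \<Rightarrow> complex) \<Rightarrow> nat set \<Rightarrow> complex" where
  "lower J f I = (if I \<inter> J = {} then f (I \<union> J) else 0)"

text \<open>The functions are total on sets of naturals; \<open>cong\<close> makes only their values
  at subsets of \<open>{..<n}\<close> count.\<close>

locale lower_stable =
  fixes n :: nat and F :: "(nat set \<Rightarrow> complex) set"
  assumes cong: "f \<in> F \<Longrightarrow> (\<And>I. I \<subseteq> {..<n} \<Longrightarrow> f I = g I) \<Longrightarrow> g \<in> F"
    and add: "f \<in> F \<Longrightarrow> g \<in> F \<Longrightarrow> (\<lambda>I. f I + g I) \<in> F"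
    and scale: "f \<in> F \<Longrightarrow> (\<lambda>I. c * f I) \<in> F"
    and lower_diff_Suc: "f \<in> F \<Longrightarrow> Suc b < n \<Longrightarrow> (\<lambda>I. lower {b} f I - lower {Suc b} f I) \<in> F"
begin

lemma lower_diff_less:
  assumes "f \<in> F" "b \<le> c" "c < n"
  shows "(\<lambda>I. lower {b} f I - lower {c} f I) \<in> F"
  using assms(2,3)
proof (induction c rule: dec_induct)
  case base
  show ?case using scale[OF assms(1), of 0] by simp
next
  case (step c)
  from add[OF step.IH lower_diff_Suc[OF assms(1), of c]] step.prems show ?case
    by simp
qed

lemma lower_diff:
  assumes "f \<in> F" "b < n" "c < n"
  shows "(\<lambda>I. lower {b} f I - lower {c} f I) \<in> F"
proof (cases "b \<le> c")
  case False
  then show ?thesis using scale[OF lower_diff_less[OF assms(1), of c b], of "-1"] assms by simp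
qed (use lower_diff_less assms in blast)

lemma lower_pair:
  assumes "f \<in> F" "b < n" "c < n" "b \<noteq> c"
  shows "lower {b, c} f \<in> F"
proof -
  let ?g = "\<lambda>I. lower {b} f I - lower {c} f I"
  have "(\<lambda>I. (- 1 / 2) * (lower {b} ?g I - lower {c} ?g I)) \<in> F"
    by (intro scale lower_diff assms)
  then show ?thesis
    by (rule cong) (use assms(4) in \<open>auto simp: lower_def insert_commute\<close>)
qed

lemma lower_closed:
  assumes "J \<subseteq> {..<n}" "2 \<le> card J" "f \<in> F"
  shows "lower J f \<in> F"
proof -
  have "card J = k + 2 \<Longrightarrow> lower J f \<in> F" for k
    using assms(1,3)
  proof (induction k arbitrary: J f)
    case 0
    then obtain b c where "J = {b, c}" "b \<noteq> c" by (metis add_0 card_2_iff)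
    then show ?case using 0 lower_pair by auto
  next
    case (Suc k)
    obtain i J' where J: "J = insert i J'" "i \<notin> J'" "card J' = k + 2"
      using Suc.prems(1) by (metis add_Suc card_Suc_eq)
    obtain j where j: "j \<in> J'" using J(3) by fastforce
    \<comment> \<open>As \<open>j\<close> lies in \<open>J'\<close>, applying
      \<open>lower {j}\<close> and then \<open>lower J'\<close> gives zero, so only
      \<open>lower J f\<close> survives.\<close>
    have "lower J' (\<lambda>I. lower {i} f I - lower {j} f I) \<in> F"
      using Suc.prems J j by (intro Suc.IH lower_diff) auto
    then show ?case
      by (rule cong) (use J j in \<open>auto simp: lower_def\<close>)
  qed
  then show ?thesis using le_Suc_ex[OF assms(2)] by (metis add.commute)
qed

text \<open>For \<open>J = {..<n} - M\<close>, the function \<open>lower J w\<close> is nonzero at \<open>M\<close> and vanishes outside the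
  subsets of \<open>M\<close>, so it can be used to clear the value at a maximal \<open>M\<close> of the support.\<close>

lemma small_support_mem:
  assumes w: "w \<in> F" "w {..<n} \<noteq> 0"
    and v: "\<And>I. I \<subseteq> {..<n} \<Longrightarrow> v I \<noteq> 0 \<Longrightarrow> card I + 2 \<le> n"
  shows "v \<in> F"
proof -
  \<comment> \<open>The support is bounded by a downward closed \<open>S\<close>. Clearing a maximal
    \<open>M\<close> alters, among subsets of \<open>{..<n}\<close>, only values at subsets of
    \<open>M\<close>, and \<open>S - {M}\<close> is again downward closed.\<close>
  have mem: "v \<in> F"
    if "finite S" "S \<subseteq> {I. I \<subseteq> {..<n} \<and> card I + 2 \<le> n}" "\<And>I I'. I \<in> S \<Longrightarrow> I' \<subseteq> I \<Longrightarrow> I' \<in> S"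
      "\<And>I. I \<subseteq> {..<n} \<Longrightarrow> I \<notin> S \<Longrightarrow> v I = 0" for S v
    using that
  proof (induction S arbitrary: v rule: finite_psubset_induct)
    case (psubset S)
    show ?case
    proof (cases "S = {}")
      case True
      show ?thesis by (rule cong[OF scale[OF w(1), of 0]]) (use psubset.prems True in auto)
    next
      case False
      then obtain M where M: "M \<in> S" "\<And>I. I \<in> S \<Longrightarrow> M \<subseteq> I \<Longrightarrow> I = M"
        using finite_has_maximal[OF \<open>finite S\<close>] by metis
      let ?J = "{..<n} - M" and ?c = "v M / w {..<n}"
      have Mn: "M \<subseteq> {..<n}" "card M + 2 \<le> n" using M(1) psubset.prems by auto
      then have "card ?J = n - card M" by (simp add: card_Diff_subset finite_subset)
      then have J: "lower ?J w \<in> F" using Mn w by (intro lower_closed) auto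
      have top: "M \<union> ?J = {..<n}" using Mn by auto
      have "(\<lambda>I. v I + (- ?c) * lower ?J w I) \<in> F"
      proof (rule psubset.IH[of "S - {M}"])
        show "S - {M} \<subset> S" using M by auto
        show "v I + (- ?c) * lower ?J w I = 0" if I: "I \<subseteq> {..<n}" "I \<notin> S - {M}" for I
        proof (cases "I = M")
          case True
          then show ?thesis using w(2) top by (simp add: lower_def)
        next
          case False
          then have "v I = 0" "\<not> I \<subseteq> M" using I psubset.prems M by blast+
          then show ?thesis using I by (auto simp: lower_def)
        qed
      qed (use psubset.prems M in blast)+
      from add[OF this scale[OF J, of ?c]] show ?thesis by simp
    qed
  qed
  show ?thesis
  proof (rule mem[of "{I. I \<subseteq> {..<n} \<and> card I + 2 \<le> n}"])
    fix I I' assume "I \<in> {I. I \<subseteq> {..<n} \<and> card I + 2 \<le> n}" "I' \<subseteq> I"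
    then show "I' \<in> {I. I \<subseteq> {..<n} \<and> card I + 2 \<le> n}"
      using card_mono[of I I'] finite_subset[of I "{..<n}"] by auto
  qed (use v in auto)
qed

end

lemma lower_stable_disjoint_trivial:
  assumes "lower_stable n F" "lower_stable n F'" "3 \<le> n"
    and w: "w \<in> F" "w {..<n} \<noteq> 0"
    and disj: "\<And>f I. f \<in> F \<Longrightarrow> f \<in> F' \<Longrightarrow> I \<subseteq> {..<n} \<Longrightarrow> f I = 0"
    and v: "v \<in> F'" and I: "I \<subseteq> {..<n}"
  shows "v I = 0"
proof -
  interpret F: lower_stable n F by fact
  interpret F': lower_stable n F' by fact
  have big: "v J = 0" if J: "J \<subseteq> {..<n}" "2 \<le> card J" for J
  proof -
    have "card I + 2 \<le> n" if "I \<subseteq> {..<n}" "lower J v I \<noteq> 0" for I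
    proof -
      have "I \<inter> J = {}" using that by (auto simp: lower_def split: if_splits)
      then have "card I + card J = card (I \<union> J)"
        using that J by (metis card_Un_disjoint finite_lessThan finite_subset)
      also have "\<dots> \<le> n" using card_mono[of "{..<n}" "I \<union> J"] that J by simp
      finally show ?thesis using J by simp
    qed
    then have "lower J v \<in> F" by (rule F.small_support_mem[OF w])
    \<comment> \<open>\<open>lower J v\<close> lies in both spaces, and its value at
      \<open>{}\<close> is \<open>v J\<close>.\<close>
    then have "lower J v {} = 0" using F'.lower_closed[OF J v] disj by blast
    then show ?thesis by (simp add: lower_def)
  qed
  have "v \<in> F"
  proof (rule F.small_support_mem[OF w])
    fix I assume "I \<subseteq> {..<n}" "v I \<noteq> 0"
    then have "card I \<le> 1" using big[of I] by fastforce
    then show "card I + 2 \<le> n" using \<open>3 \<le> n\<close> by simp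
  qed
  then show ?thesis using disj v I by blast
qed


section \<open>Coordinates of the tensor power\<close>

text \<open>The coordinate with index \<open>k\<close> belongs to the pure tensor with \<open>e\<^sub>2\<close> at the binary digits of \<open>k\<close>
  that are \<open>1\<close> and \<open>e\<^sub>1\<close> elsewhere. Positions are thus counted from the right, starting with \<open>0\<close>: the
  pair \<open>b, Suc b\<close> is the site \<open>n - Suc b\<close>.\<close>

definition set_vec :: "nat \<Rightarrow> (nat set \<Rightarrow> complex) \<Rightarrow> complex vec" where
  "set_vec n f = vec (2 ^ n) (\<lambda>k. f (set_decode k))"

lemma set_decode_subset: "k < 2 ^ n \<Longrightarrow> set_decode k \<subseteq> {..<n}"
proof
  fix b assume k: "k < 2 ^ n" and "b \<in> set_decode k"
  then have "k div 2 ^ b \<noteq> 0" by (auto simp: set_decode_def intro: Nat.gr0I)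
  then have "2 ^ b \<le> k" by (metis div_less not_le)
  then have "(2 :: nat) ^ b < 2 ^ n" using k by (rule le_less_trans)
  then show "b \<in> {..<n}" by simp
qed

lemma set_encode_less:
  assumes "I \<subseteq> {..<n}"
  shows "set_encode I < 2 ^ n"
proof -
  have "set_encode I \<le> (\<Sum>b<n. 2 ^ b)"
    unfolding set_encode_def using assms by (intro sum_mono2) auto
  also have "\<dots> < 2 ^ n" by (simp add: lessThan_atLeast0 sum_power2)
  finally show ?thesis .
qed

lemma set_vec_carrier [simp]: "set_vec n f \<in> carrier_vec (2 ^ n)"
  by (simp add: set_vec_def)

lemma dim_set_vec [simp]: "dim_vec (set_vec n f) = 2 ^ n"
  by (simp add: set_vec_def)

lemma set_vec_encode:
  "I \<subseteq> {..<n} \<Longrightarrow> set_vec n f $ set_encode I = f I"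
  using finite_subset[of I "{..<n}"] by (simp add: set_vec_def set_encode_less)

lemma set_vec_cong: "(\<And>I. I \<subseteq> {..<n} \<Longrightarrow> f I = g I) \<Longrightarrow> set_vec n f = set_vec n g"
  by (auto simp: set_vec_def set_decode_subset)

lemma set_vec_of_vec: "v \<in> carrier_vec (2 ^ n) \<Longrightarrow> set_vec n (\<lambda>I. v $ set_encode I) = v"
  by (auto simp: set_vec_def)

lemma set_vec_add: "set_vec n f + set_vec n g = set_vec n (\<lambda>I. f I + g I)"
  by (auto simp: set_vec_def)

lemma set_vec_smult: "c \<cdot>\<^sub>v set_vec n f = set_vec n (\<lambda>I. c * f I)"
  by (auto simp: set_vec_def)

lemma set_vec_zero: "0\<^sub>v (2 ^ n) = set_vec n (\<lambda>I. 0)"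
  by (auto simp: set_vec_def)

text \<open>Position \<open>Suc b\<close> stands to the left of \<open>b\<close>, so it is the high
  digit of an index into a 4 by 4 matrix.\<close>

definition block_code :: "nat \<Rightarrow> nat set \<Rightarrow> nat" where
  "block_code b I = of_bool (b \<in> I) + 2 * of_bool (Suc b \<in> I)"

definition block_set :: "nat \<Rightarrow> nat \<Rightarrow> nat set" where
  "block_set b t = (if odd t then {b} else {}) \<union> (if 2 \<le> t then {Suc b} else {})"

lemma block_code_decode: "k mod (4 * 2 ^ b) div 2 ^ b = block_code b (set_decode k)"
proof -
  have "k mod (4 * 2 ^ b) div 2 ^ b = k div 2 ^ b mod 4"
    using mod_mult2_eq[of k "2 ^ b" 4] by (simp add: mult.commute)
  moreover have "x mod 4 = of_bool (odd x) + 2 * of_bool (odd (x div 2))" for x :: nat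
    using mod_mult2_eq[of x 2 2] by (simp add: mod_2_eq_odd)
  moreover have "k div 2 ^ Suc b = k div 2 ^ b div 2"
    by (metis div_mult2_eq mult.commute power_Suc)
  ultimately show ?thesis by (simp add: block_code_def set_decode_def)
qed

lemma set_encode_block:
  assumes "finite I" "b \<notin> I" "Suc b \<notin> I" "t < 4"
  shows "set_encode (I \<union> block_set b t) = set_encode I + t * 2 ^ b"
proof -
  consider "t = 0" | "t = 1" | "t = 2" | "t = 3" using assms(4) by linarith
  then show ?thesis using assms(1-3) by cases (simp_all add: block_set_def)
qed

lemma block_set_code: "I - {b, Suc b} \<union> block_set b (block_code b I) = I"
  by (auto simp: block_code_def block_set_def)

text \<open>Cut \<open>k\<close> into high digits, the pair at \<open>b\<close> and
  \<open>Suc b\<close>, and low digits. The high and low parts together encode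
  \<open>set_decode k - {b, Suc b}\<close>, and \<open>t\<close> becomes the new pair.\<close>

lemma block_replace_decode:
  assumes "t < 4"
  shows "set_decode (k div (4 * 2 ^ b) * (4 * 2 ^ b) + (t * 2 ^ b + k mod 2 ^ b))
    = set_decode k - {b, Suc b} \<union> block_set b t"
proof -
  let ?I = "set_decode k" and ?m = "2 ^ b :: nat"
  let ?K = "?I - {b, Suc b}" and ?c = "block_code b (set_decode k)"
  have I: "?K \<union> block_set b ?c = ?I" by (rule block_set_code)
  have "?c < 4" by (simp add: block_code_def)
  have "k = k div (4 * ?m) * (4 * ?m) + k mod (4 * ?m)" by (rule div_mult_mod_eq[symmetric])
  also have "k mod (4 * ?m) = ?c * ?m + k mod (4 * ?m) mod ?m"
    unfolding block_code_decode[symmetric] by (rule div_mult_mod_eq[symmetric])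
  also have "k mod (4 * ?m) mod ?m = k mod ?m" by (simp add: mod_mod_cancel)
  finally have "k = k div (4 * ?m) * (4 * ?m) + (?c * ?m + k mod ?m)" .
  moreover have "k = set_encode ?K + ?c * ?m"
    using set_encode_block[of ?K b ?c] I \<open>?c < 4\<close> by simp
  ultimately have "k div (4 * ?m) * (4 * ?m) + k mod ?m = set_encode ?K" by linarith
  then have "k div (4 * ?m) * (4 * ?m) + (t * ?m + k mod ?m) = set_encode (?K \<union> block_set b t)"
    using set_encode_block[of ?K b t] assms by simp
  then show ?thesis by (simp add: block_set_def)
qed

text \<open>The identity factors kill every entry whose row and column differ in a digit other than
  \<open>b\<close> and \<open>Suc b\<close>, so four columns remain, one for each new pair of
  digits.\<close>

lemma site_op_set_vec:
  assumes A: "A \<in> carrier_mat 4 4" and b: "Suc b < n"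
  shows "site_op n (n - Suc b) A *\<^sub>v set_vec n f
    = set_vec n (\<lambda>I. \<Sum>t<4. A $$ (block_code b I, t) * f (I - {b, Suc b} \<union> block_set b t))"
    (is "?M *\<^sub>v _ = set_vec n ?g")
proof (rule eq_vecI)
  define m where "m = (2 :: nat) ^ b"
  define a where "a = (2 :: nat) ^ (n - Suc b - 1)"
  have m: "0 < m" by (simp add: m_def)
  have "n - Suc b - 1 + (2 + b) = n" using b by simp
  then have "(2 :: nat) ^ n = 2 ^ (n - Suc b - 1 + (2 + b))" by (simp only:)
  then have "2 ^ n = a * (2\<^sup>2 * m)" by (simp only: power_add a_def m_def)
  then have N: "2 ^ n = a * (4 * m)" by simp
  have M: "?M = 1\<^sub>m a \<otimes>\<^sub>K A \<otimes>\<^sub>K 1\<^sub>m m"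
    using b by (simp add: site_op_alt a_def m_def)
  have AM: "A \<otimes>\<^sub>K 1\<^sub>m m \<in> carrier_mat (4 * m) (4 * m)" by (rule kron_carrier[OF A one_carrier_mat])
  have Mc: "?M \<in> carrier_mat (2 ^ n) (2 ^ n)"
    unfolding M N by (rule kron_carrier[OF one_carrier_mat AM])
  fix k assume "k < dim_vec (set_vec n ?g)"
  then have k: "k < a * (4 * m)" by (simp add: set_vec_def N)
  let ?F = "\<lambda>y. f (set_decode y)"
  have k1: "k div (4 * m) < a" "k mod (4 * m) < 4 * m"
    using k m by (simp_all add: less_mult_imp_div_less)
  then have k2: "k mod (4 * m) div m < 4" by (simp add: less_mult_imp_div_less)
  have ent: "?M $$ (k, y) = (if k div (4 * m) = y div (4 * m) then
      A $$ (k mod (4 * m) div m, y mod (4 * m) div m)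
        * (if k mod (4 * m) mod m = y mod (4 * m) mod m then 1 else 0) else 0)"
    if y: "y < a * (4 * m)" for y
  proof -
    have y1: "y div (4 * m) < a" "y mod (4 * m) < 4 * m"
      using y m by (simp_all add: less_mult_imp_div_less)
    show ?thesis unfolding M kron_index[OF one_carrier_mat AM k y]
        kron_index[OF A one_carrier_mat k1(2) y1(2)] using k1 y1 m by simp
  qed
  have "(?M *\<^sub>v set_vec n f) $ k = (\<Sum>y<a * (4 * m). ?M $$ (k, y) * ?F y)"
    using Mc k by (simp add: scalar_prod_def set_vec_def N atLeast0LessThan)
  \<comment> \<open>Written as a function of quotient and remainder, the summand fits
    \<open>sum_div_mod\<close>.\<close>
  also have "\<dots> = (\<Sum>y<a * (4 * m). (\<lambda>h z. if k div (4 * m) = h then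
      A $$ (k mod (4 * m) div m, z div m) * (if k mod (4 * m) mod m = z mod m then 1 else 0)
        * ?F (h * (4 * m) + z) else 0) (y div (4 * m)) (y mod (4 * m)))"
    by (intro sum.cong refl) (simp only: ent lessThan_iff div_mult_mod_eq, simp)
  also have "\<dots> = (\<Sum>h<a. \<Sum>z<4 * m. if k div (4 * m) = h then
      A $$ (k mod (4 * m) div m, z div m) * (if k mod (4 * m) mod m = z mod m then 1 else 0)
        * ?F (h * (4 * m) + z) else 0)"
    by (rule sum_div_mod)
  also have "\<dots> = (\<Sum>h<a. if k div (4 * m) = h then \<Sum>z<4 * m.
      A $$ (k mod (4 * m) div m, z div m) * (if k mod (4 * m) mod m = z mod m then 1 else 0)
        * ?F (h * (4 * m) + z) else 0)"
    by (intro sum.cong refl) simp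
  also have "\<dots> = (\<Sum>z<4 * m.
      A $$ (k mod (4 * m) div m, z div m) * (if k mod (4 * m) mod m = z mod m then 1 else 0)
        * ?F (k div (4 * m) * (4 * m) + z))"
    using k1 by simp
  also have "\<dots> = (\<Sum>z<4 * m. (\<lambda>t l. if k mod m = l then A $$ (k mod (4 * m) div m, t)
        * ?F (k div (4 * m) * (4 * m) + (t * m + l)) else 0) (z div m) (z mod m))"
    by (intro sum.cong refl) (simp add: mod_mod_cancel)
  also have "\<dots> = (\<Sum>t<4. \<Sum>l<m. if k mod m = l then A $$ (k mod (4 * m) div m, t)
        * ?F (k div (4 * m) * (4 * m) + (t * m + l)) else 0)"
    by (rule sum_div_mod)
  also have "\<dots> = (\<Sum>t<4. A $$ (k mod (4 * m) div m, t)
        * ?F (k div (4 * m) * (4 * m) + (t * m + k mod m)))"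
    using m by simp
  also have "\<dots> = ?g (set_decode k)"
    by (intro sum.cong refl) (simp add: m_def block_code_decode block_replace_decode)
  also have "\<dots> = set_vec n ?g $ k"
    using k by (simp add: set_vec_def N)
  finally show "(?M *\<^sub>v set_vec n f) $ k = set_vec n ?g $ k" .
next
  have "?M \<in> carrier_mat (2 ^ n) (2 ^ n)"
    using b by (intro site_carrier A) auto
  then show "dim_vec (?M *\<^sub>v set_vec n f) = dim_vec (set_vec n ?g)" by (simp add: set_vec_def)
qed

text \<open>The branches are the rows of \<open>glue_mat c\<close>, from the last to the
  first.\<close>

definition glue_fun :: "nat \<Rightarrow> complex \<Rightarrow> (nat set \<Rightarrow> complex) \<Rightarrow> nat set \<Rightarrow> complex" where
  "glue_fun b c f I = (let J = I - {b, Suc b} in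
     if Suc b \<in> I then if b \<in> I then f I else f (insert b J) - c * f (insert b (insert (Suc b) J))
     else if b \<in> I then f (insert (Suc b) J) + c * f (insert b (insert (Suc b) J))
     else f I + c * f (insert b I) - c * f (insert (Suc b) I) - c\<^sup>2 * f (insert b (insert (Suc b) I)))"

lemma glue_set_vec:
  assumes "Suc b < n"
  shows "site_op n (n - Suc b) (glue_mat c) *\<^sub>v set_vec n f = set_vec n (glue_fun b c f)"
  unfolding site_op_set_vec[OF glue_carrier assms]
proof (rule set_vec_cong)
  fix I :: "nat set"
  have four: "(\<Sum>t<4. g t) = g 0 + g 1 + g 2 + g 3" for g :: "nat \<Rightarrow> complex"
    by (simp add: numeral_eq_Suc)
  have ins: "b \<in> I \<Longrightarrow> Suc b \<in> I \<Longrightarrow> insert b (insert (Suc b) (I - {b, Suc b})) = I" by auto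
  show "(\<Sum>t<4. glue_mat c $$ (block_code b I, t) * f (I - {b, Suc b} \<union> block_set b t))
      = glue_fun b c f I"
    unfolding four
    by (cases "b \<in> I"; cases "Suc b \<in> I")
      (simp_all add: block_code_def block_set_def glue_mat_def rows_entry glue_fun_def ins Let_def insert_commute)
qed


section \<open>Subrepresentations of the mixed doubles representation\<close>

lemma subspace_module_vec_iff:
  "subspace class_ring W (module_vec TYPE(complex) d) \<longleftrightarrow>
    W \<subseteq> carrier_vec d \<and> 0\<^sub>v d \<in> W \<and> (\<forall>v\<in>W. \<forall>w\<in>W. v + w \<in> W) \<and> (\<forall>c. \<forall>v\<in>W. c \<cdot>\<^sub>v v \<in> W)"
  unfolding VectorSpace.subspace_def submodule_def module_vec_simps
  using vec_vs vec_module by auto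

lemma submodule_sum_module_vec:
  "module.submodule_sum (module_vec TYPE(complex) d) W W' = {v + w | v w. v \<in> W \<and> w \<in> W'}"
  unfolding module.submodule_sum_def[OF vec_module] module_vec_simps by auto

lemma subrepresentation_site_op:
  assumes "subrepresentation (MD n) (2 ^ n) (md_rep n (glue_mat q) (glue_mat p)) W"
    and "c \<in> {q, p}" "Suc b < n" "w \<in> W"
  shows "site_op n (n - Suc b) (glue_mat c) *\<^sub>v w \<in> W"
proof -
  have i: "1 \<le> n - Suc b" "n - Suc b < n" using assms(3) by auto
  then have "md_r n (n - Suc b) \<in> carrier (MD n)" "md_s n (n - Suc b) \<in> carrier (MD n)"
    by (auto simp: MD_def presented_group_def md_r_def md_s_def md_gens_iff intro!: imageI)
  then show ?thesis
    using assms(1,2,4) md_rep_gens[OF i, of q p] unfolding subrepresentation_def by auto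
qed

text \<open>Generators act as involutions, so an inverse letter acts as the letter itself and
  closure under generators extends to all words.\<close>

lemma subrepresentationI:
  assumes W: "subspace class_ring W (module_vec TYPE(complex) (2 ^ n))"
    and closed: "\<And>b c w. c \<in> {q, p} \<Longrightarrow> Suc b < n \<Longrightarrow> w \<in> W
      \<Longrightarrow> site_op n (n - Suc b) (glue_mat c) *\<^sub>v w \<in> W"
  shows "subrepresentation (MD n) (2 ^ n) (md_rep n (glue_mat q) (glue_mat p)) W"
proof -
  let ?f = "md_gen_image n (glue_mat q) (glue_mat p)" and ?G = "GL (2 ^ n)"
  have Wc: "w \<in> carrier_vec (2 ^ n)" if "w \<in> W" for w
    using W that unfolding subspace_module_vec_iff by blast
  have gen: "?f x *\<^sub>v w \<in> W" if x: "x \<in> md_gens n" and w: "w \<in> W" for x w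
  proof -
    from x obtain i where i: "1 \<le> i" "i < n" "x = s_gen i \<or> x = r_gen i"
      by (auto simp: md_gens_def)
    then have "Suc (n - Suc i) < n" "i = n - Suc (n - Suc i)" by auto
    then show ?thesis using closed[of _ "n - Suc i" w] w i(3) by auto
  qed
  have inv: "inv\<^bsub>?G\<^esub> (?f x) = ?f x" if x: "x \<in> md_gens n" for x
  proof (rule group.inv_equality[OF group_GL])
    show "?f x \<otimes>\<^bsub>?G\<^esub> ?f x = \<one>\<^bsub>?G\<^esub>"
      using x by (auto simp: md_gens_def GL_simps site_square)
  qed (use md_gen_image_closed[OF x] in auto)
  have GL_mat: "A \<in> carrier_mat (2 ^ n) (2 ^ n)" if "A \<in> carrier ?G" for A
    using that by (auto simp: GL_def units_of_def Units_def ring_mat_simps)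
  have word: "word_eval ?G ?f u *\<^sub>v w \<in> W" if "u \<in> lists (md_gens n \<times> UNIV)" "w \<in> W" for u w
    using that
  proof (induction u rule: list.induct)
    case Nil
    then show ?case using Wc by (simp add: GL_simps)
  next
    case (Cons l u)
    obtain x e where l: "l = (x, e)" by force
    have x: "x \<in> md_gens n" and u: "u \<in> lists (md_gens n \<times> UNIV)"
      using Cons.prems(1) unfolding l by auto
    have "word_eval ?G ?f u \<in> carrier ?G"
      by (rule word_eval_closed[OF group_GL md_gen_image_closed md_rels_words md_rels_respected u])
    then have "word_eval ?G ?f (l # u) *\<^sub>v w = ?f x *\<^sub>v (word_eval ?G ?f u *\<^sub>v w)"
      using assoc_mult_mat_vec[OF GL_mat[OF md_gen_image_closed[OF x]] GL_mat Wc] Cons.prems(2)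
      by (simp add: l inv[OF x] GL_simps)
    then show ?case using gen[OF x] Cons.IH[OF u Cons.prems(2)] by simp
  qed
  show ?thesis
    unfolding subrepresentation_def
  proof (intro conjI ballI W)
    fix g w assume g: "g \<in> carrier (MD n)" and w: "w \<in> W"
    from g obtain u where u: "u \<in> lists (md_gens n \<times> UNIV)" "g = pres_class (md_gens n) (md_rels n) u"
      by (auto simp: MD_def presented_group_def)
    have "md_rep n (glue_mat q) (glue_mat p) g = word_eval ?G ?f u"
      unfolding md_rep_def u(2)
      by (rule pres_hom_class[OF group_GL md_gen_image_closed md_rels_words md_rels_respected u(1)])
    then show "md_rep n (glue_mat q) (glue_mat p) g *\<^sub>v w \<in> W" using word[OF u(1) w] by simp
  qed
qed

section \<open>The case of distinct parameters\<close>

text \<open>With \<open>D = lower {b} - lower {Suc b}\<close> one has \<open>D\<^sup>2 = - 2 lower {b, Suc b}\<close> and \<open>D\<^sup>3 = 0\<close>, so the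
  composition is \<open>exp ((q - p) D)\<close>; the next lemma recovers \<open>D\<close> by taking the logarithm
  \<open>(M - 1) - (M - 1)\<^sup>2 / 2\<close>.\<close>

lemma glue_fun_comp:
  "glue_fun b p (glue_fun b q f) = (\<lambda>I. f I + (q - p) * (lower {b} f I - lower {Suc b} f I)
    - (q - p)\<^sup>2 * lower {b, Suc b} f I)"
proof
  fix I :: "nat set"
  have D: "insert b (I - {b, Suc b}) - {b, Suc b} = I - {b, Suc b}"
    "insert (Suc b) (I - {b, Suc b}) - {b, Suc b} = I - {b, Suc b}"
    "I - {b, Suc b} - {b, Suc b} = I - {b, Suc b}"
    "insert b I - {b, Suc b} = I - {b, Suc b}"
    "insert (Suc b) I - {b, Suc b} = I - {b, Suc b}"
    "insert (Suc b) (insert b I) - {b, Suc b} = I - {b, Suc b}"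
    by auto
  let ?J = "I - {b, Suc b}"
  consider "b \<in> I" "Suc b \<in> I" | "I = insert b ?J" "b \<in> I" "Suc b \<notin> I"
    | "I = insert (Suc b) ?J" "b \<notin> I" "Suc b \<in> I" | "I = ?J" "b \<notin> I" "Suc b \<notin> I" by blast
  then show "glue_fun b p (glue_fun b q f) I = f I + (q - p) * (lower {b} f I - lower {Suc b} f I)
      - (q - p)\<^sup>2 * lower {b, Suc b} f I"
  proof cases
    case 1
    then show ?thesis by (simp add: glue_fun_def lower_def)
  next
    case 2
    have "glue_fun b p (glue_fun b q f) (insert b ?J)
        = f (insert b ?J) - (q - p) * f (insert b (insert (Suc b) ?J))"
      by (simp add: glue_fun_def Let_def D algebra_simps insert_commute)
    then show ?thesis using 2 by (simp add: lower_def) (metis insert_commute)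
  next
    case 3
    have "glue_fun b p (glue_fun b q f) (insert (Suc b) ?J)
        = f (insert (Suc b) ?J) + (q - p) * f (insert b (insert (Suc b) ?J))"
      by (simp add: glue_fun_def Let_def D algebra_simps insert_commute)
    then show ?thesis using 3 by (simp add: lower_def)
  next
    case 4
    then show ?thesis
      by (simp add: glue_fun_def lower_def Let_def algebra_simps insert_commute power2_eq_square)
  qed
qed

text \<open>Expanding the logarithm gives the coefficients 2, -1/2 and -3/2; the series stops there
  because \<open>(M - 1)^3 = 0\<close>.\<close>

lemma glue_fun_log:
  defines "M \<equiv> \<lambda>b q p f. glue_fun b p (glue_fun b q f)"
  shows "2 * M b q p f I + (- 1 / 2) * M b q p (M b q p f) I + (- 3 / 2) * f I
    = (q - p) * (lower {b} f I - lower {Suc b} f I)"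
proof -
  define d where "d = q - p"
  show ?thesis
    unfolding M_def glue_fun_comp d_def[symmetric]
    by (cases "b \<in> I"; cases "Suc b \<in> I")
      (simp_all add: lower_def insert_commute field_simps power2_eq_square)
qed

text \<open>The logarithm is a polynomial in a composition of site operators, so it preserves
  \<open>W\<close>; dividing by \<open>q - p\<close> leaves the difference of lowerings.\<close>

lemma subrepresentation_lower_stable:
  assumes W: "subrepresentation (MD n) (2 ^ n) (md_rep n (glue_mat q) (glue_mat p)) W"
    and "q \<noteq> p"
  shows "lower_stable n {f. set_vec n f \<in> W}"
proof
  have add: "v + w \<in> W" if "v \<in> W" "w \<in> W" for v w
    using W that unfolding subrepresentation_def subspace_module_vec_iff by blast
  have smult: "c \<cdot>\<^sub>v v \<in> W" if "v \<in> W" for c v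
    using W that unfolding subrepresentation_def subspace_module_vec_iff by blast
  fix f g :: "nat set \<Rightarrow> complex" and b :: nat and c :: complex
  show "g \<in> {f. set_vec n f \<in> W}"
    if "f \<in> {f. set_vec n f \<in> W}" "\<And>I. I \<subseteq> {..<n} \<Longrightarrow> f I = g I"
    using that set_vec_cong[of n f g] by simp
  show "(\<lambda>I. f I + g I) \<in> {f. set_vec n f \<in> W}"
    if "f \<in> {f. set_vec n f \<in> W}" "g \<in> {f. set_vec n f \<in> W}"
    using that add[of "set_vec n f" "set_vec n g"] by (simp add: set_vec_add)
  have scale: "set_vec n (\<lambda>I. c * f I) \<in> W" if "set_vec n f \<in> W" for c f
    using that smult[of "set_vec n f"] by (simp add: set_vec_smult)
  then show "(\<lambda>I. c * f I) \<in> {f. set_vec n f \<in> W}" if "f \<in> {f. set_vec n f \<in> W}"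
    using that by simp
  show "(\<lambda>I. lower {b} f I - lower {Suc b} f I) \<in> {f. set_vec n f \<in> W}"
    if f: "f \<in> {f. set_vec n f \<in> W}" and b: "Suc b < n"
  proof -
    have glue: "set_vec n (glue_fun b c f) \<in> W" if "c \<in> {q, p}" "set_vec n f \<in> W" for c f
      using subrepresentation_site_op[OF W that(1) b that(2)] by (simp add: glue_set_vec[OF b])
    define M where "M f = glue_fun b p (glue_fun b q f)" for f
    have M: "set_vec n (M f) \<in> W" if "set_vec n f \<in> W" for f
      unfolding M_def using that by (intro glue) auto
    have "set_vec n (\<lambda>I. 2 * M f I + (- 1 / 2) * M (M f) I + (- 3 / 2) * f I) \<in> W"
      unfolding set_vec_add[symmetric] using f by (intro add scale M) auto
    then have "set_vec n (\<lambda>I. (q - p) * (lower {b} f I - lower {Suc b} f I)) \<in> W"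
      unfolding M_def glue_fun_log .
    from scale[OF this, of "1 / (q - p)"] show ?thesis using \<open>q \<noteq> p\<close> by simp
  qed
qed

lemma indecomposable_glue:
  assumes "3 \<le> n" "q \<noteq> p"
  shows "indecomposable (MD n) (2 ^ n) (md_rep n (glue_mat q) (glue_mat p))"
proof -
  let ?sub = "subrepresentation (MD n) (2 ^ n) (md_rep n (glue_mat q) (glue_mat p))"
  have triv: "W' = {0\<^sub>v (2 ^ n)}"
    if W: "?sub W" and W': "?sub W'" and int: "W \<inter> W' = {0\<^sub>v (2 ^ n)}"
      and f: "set_vec n f \<in> W" "f {..<n} \<noteq> 0" for W W' f
  proof -
    have "w = 0\<^sub>v (2 ^ n)" if w: "w \<in> W'" for w
    proof -
      define g where "g I = w $ set_encode I" for I
      have "w \<in> carrier_vec (2 ^ n)"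
        using W' w unfolding subrepresentation_def subspace_module_vec_iff by auto
      then have g: "set_vec n g = w" unfolding g_def by (rule set_vec_of_vec)
      have "g I = 0" if "I \<subseteq> {..<n}" for I
      proof (rule lower_stable_disjoint_trivial[where w = f and v = g])
        show "lower_stable n {f. set_vec n f \<in> W}" "lower_stable n {f. set_vec n f \<in> W'}"
          using subrepresentation_lower_stable W W' \<open>q \<noteq> p\<close> by blast+

        fix h I assume h: "h \<in> {f. set_vec n f \<in> W}" "h \<in> {f. set_vec n f \<in> W'}" "I \<subseteq> {..<n}"
        then have "set_vec n h = set_vec n (\<lambda>I. 0)" using int by (auto simp: set_vec_zero)
        then show "h I = 0" using set_vec_encode[OF h(3)] by metis
      qed (use f w g that \<open>3 \<le> n\<close> in auto)
      then show ?thesis using set_vec_cong[of n g "\<lambda>I. 0"] by (simp add: g set_vec_zero)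
    qed
    then show ?thesis using int by blast
  qed
  \<comment> \<open>The constant function 1 serves as a vector with nonzero coordinate at
    \<open>{..<n}\<close>: when it is split along \<open>W\<close> and \<open>W'\<close>, one
    component keeps that property and \<open>triv\<close> applies to it.\<close>
  have one: "set_vec n (\<lambda>I. 1) $ set_encode {..<n} = 1" by (simp add: set_vec_encode)
  have "set_vec n (\<lambda>I. 1) \<noteq> 0\<^sub>v (2 ^ n)"
    using one by (auto simp: set_encode_less)
  then have "carrier_vec (2 ^ n) \<noteq> {0\<^sub>v (2 ^ n) :: complex vec}"
    using set_vec_carrier[of n "\<lambda>I. 1"] by blast
  moreover have False
    if W: "?sub W" "?sub W'" "W \<noteq> {0\<^sub>v (2 ^ n)}" "W' \<noteq> {0\<^sub>v (2 ^ n)}" "W \<inter> W' = {0\<^sub>v (2 ^ n)}"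
      and sum: "module.submodule_sum (module_vec TYPE(complex) (2 ^ n)) W W' = carrier_vec (2 ^ n)"
    for W W'
  proof -
    have "set_vec n (\<lambda>I. 1) \<in> module.submodule_sum (module_vec TYPE(complex) (2 ^ n)) W W'"
      unfolding sum by simp
    then obtain v w where vw: "v \<in> W" "w \<in> W'" "set_vec n (\<lambda>I. 1) = v + w"
      unfolding submodule_sum_module_vec by blast
    define f g where "f I = v $ set_encode I" and "g I = w $ set_encode I" for I
    have c: "v \<in> carrier_vec (2 ^ n)" "w \<in> carrier_vec (2 ^ n)"
      using W(1,2) vw unfolding subrepresentation_def subspace_module_vec_iff by auto
    then have fg: "set_vec n f = v" "set_vec n g = w"
      unfolding f_def g_def by (simp_all add: set_vec_of_vec)
    have "f {..<n} + g {..<n} = 1"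
      using one c unfolding vw(3) f_def g_def by (simp add: set_encode_less)
    then have "f {..<n} \<noteq> 0 \<or> g {..<n} \<noteq> 0" by auto
    then show False
      using triv[OF W(1,2), of f] triv[OF W(2,1), of g] W(3-5) vw fg by (auto simp: Int_commute)
  qed
  ultimately show ?thesis
    unfolding indecomposable_def using md_rep_representation by blast
qed

section \<open>The case of equal parameters\<close>

text \<open>\<open>glue_fixed n p\<close> is the product vector with factor \<open>e\<^sub>2 + p b e\<^sub>1\<close> at position \<open>b\<close>.
  \<open>glue_mat c\<close> maps \<open>(e\<^sub>2 + x e\<^sub>1) \<otimes> (e\<^sub>2 + y e\<^sub>1)\<close> to \<open>(e\<^sub>2 + (y + c) e\<^sub>1) \<otimes> (e\<^sub>2 + (x - c) e\<^sub>1)\<close>.\<close>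

definition glue_fixed :: "nat \<Rightarrow> complex \<Rightarrow> nat set \<Rightarrow> complex" where
  "glue_fixed n p I = (\<Prod>b\<in>{..<n} - I. p * of_nat b)"

text \<open>From the left, positions \<open>Suc b\<close> and \<open>b\<close> carry
  \<open>x = p * (b + 1)\<close> and \<open>y = p * b\<close>, so \<open>y + p = x\<close> and
  \<open>x - p = y\<close>.\<close>

lemma glue_fun_fixed:
  assumes b: "Suc b < n"
  shows "glue_fun b p (glue_fixed n p) I = glue_fixed n p I"
proof -
  have step: "glue_fixed n p I = p * of_nat x * glue_fixed n p (insert x I)" if "x < n" "x \<notin> I" for x I
  proof -
    have "{..<n} - insert x I = {..<n} - I - {x}" by blast
    then show ?thesis
      using that unfolding glue_fixed_def by (simp only:) (rule prod.remove, auto)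
  qed
  let ?J = "I - {b, Suc b}"
  show ?thesis
  proof (cases "b \<in> I"; cases "Suc b \<in> I")
    assume "b \<in> I" "Suc b \<in> I"
    then show ?thesis by (simp add: glue_fun_def)
  next
    assume I: "b \<in> I" "Suc b \<notin> I"
    then have "insert b (insert (Suc b) ?J) = insert (Suc b) I" by auto
    then show ?thesis
      using I b step[of b "insert (Suc b) ?J"] step[of "Suc b" I]
      by (simp add: glue_fun_def algebra_simps)
  next
    assume I: "b \<notin> I" "Suc b \<in> I"
    then have "insert b (insert (Suc b) ?J) = insert b I" by auto
    then show ?thesis
      using I b step[of "Suc b" "insert b ?J"] step[of b I]
      by (simp add: glue_fun_def insert_commute algebra_simps)
  next
    assume I: "b \<notin> I" "Suc b \<notin> I"
    then show ?thesis
      using I b step[of "Suc b" "insert b I"] step[of b "insert (Suc b) I"]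
      by (simp add: glue_fun_def insert_commute algebra_simps power2_eq_square)
  qed
qed

lemma not_indecomposable_glue:
  assumes "1 \<le> n"
  shows "\<not> indecomposable (MD n) (2 ^ n) (md_rep n (glue_mat p) (glue_mat p))"
proof -
  let ?N = "2 ^ n :: nat" and ?z = "glue_fixed n p" and ?top = "set_encode {..<n}"
  let ?sub = "subrepresentation (MD n) (2 ^ n) (md_rep n (glue_mat p) (glue_mat p))"
  have top: "?top < ?N" by (simp add: set_encode_less)
  have z_top: "?z {..<n} = 1" by (simp add: glue_fixed_def)
  define W where "W = range (\<lambda>a. set_vec n (\<lambda>I. a * ?z I))"
  define W' where "W' = {v \<in> carrier_vec ?N. v $ ?top = (0 :: complex)}"
  have W_top: "set_vec n (\<lambda>I. a * ?z I) $ ?top = a" for a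
    by (simp add: set_vec_encode z_top)
  have W: "?sub W"
  proof (rule subrepresentationI)
    show "subspace class_ring W (module_vec TYPE(complex) ?N)"
      unfolding subspace_module_vec_iff
    proof (intro conjI ballI allI)
      show "0\<^sub>v ?N \<in> W" unfolding W_def set_vec_zero by (rule range_eqI[of _ _ 0]) simp
      show "v + w \<in> W" if "v \<in> W" "w \<in> W" for v w
        using that unfolding W_def by (auto simp: set_vec_add simp flip: distrib_right)
      show "c \<cdot>\<^sub>v v \<in> W" if "v \<in> W" for c v
        using that unfolding W_def by (auto simp: set_vec_smult simp flip: mult.assoc)
    qed (auto simp: W_def)
    fix b c w assume c: "c \<in> {p, p}" and b: "Suc b < n" and "w \<in> W"
    then obtain a where a: "w = set_vec n (\<lambda>I. a * ?z I)" unfolding W_def by blast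
    have "glue_fun b p (\<lambda>I. a * ?z I) = (\<lambda>I. a * glue_fun b p ?z I)"
      by (rule ext) (simp add: glue_fun_def Let_def algebra_simps)
    then show "site_op n (n - Suc b) (glue_mat c) *\<^sub>v w \<in> W"
      using c by (simp add: a glue_set_vec[OF b] glue_fun_fixed[OF b] W_def)
  qed
  have W': "?sub W'"
  proof (rule subrepresentationI)
    show "subspace class_ring W' (module_vec TYPE(complex) ?N)"
      unfolding subspace_module_vec_iff W'_def using top by auto
    fix b c w assume b: "Suc b < n" and "w \<in> W'"
    then have w: "w \<in> carrier_vec ?N" "w $ ?top = 0" by (auto simp: W'_def)
    have "site_op n (n - Suc b) (glue_mat c) *\<^sub>v w
        = set_vec n (glue_fun b c (\<lambda>I. w $ set_encode I))"
      using glue_set_vec[OF b, of c "\<lambda>I. w $ set_encode I"] set_vec_of_vec[OF w(1)] by simp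
    \<comment> \<open>\<open>glue_fun\<close> leaves the value at the full set unchanged.\<close>
    then show "site_op n (n - Suc b) (glue_mat c) *\<^sub>v w \<in> W'"
      using w b by (simp add: W'_def set_vec_encode glue_fun_def)
  qed
  have "W \<noteq> {0\<^sub>v ?N}"
  proof
    assume "W = {0\<^sub>v ?N}"
    then have "set_vec n (\<lambda>I. 1 * ?z I) = 0\<^sub>v ?N" unfolding W_def by blast
    then show False using W_top[of 1] top by simp
  qed
  moreover have "W' \<noteq> {0\<^sub>v ?N}"
  proof
    \<comment> \<open>This is the tensor with all factors \<open>e\<^sub>1\<close>; for
      \<open>n \<ge> 1\<close> its coordinate at \<open>{..<n}\<close> is 0.\<close>
    let ?e = "\<lambda>I :: nat set. of_bool (I = {}) :: complex"
    assume "W' = {0\<^sub>v ?N}"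
    moreover have "{..<n} \<noteq> {}" using assms by (simp add: lessThan_empty_iff)
    then have "set_vec n ?e \<in> W'" by (simp add: W'_def set_vec_encode)
    ultimately show False using set_vec_encode[of "{}" n ?e] by simp
  qed
  moreover have "W \<inter> W' = {0\<^sub>v ?N}"
  proof
    show "W \<inter> W' \<subseteq> {0\<^sub>v ?N}"
      using W_top by (auto simp: W_def W'_def set_vec_zero)
    show "{0\<^sub>v ?N} \<subseteq> W \<inter> W'"
      using W W' unfolding subrepresentation_def subspace_module_vec_iff by blast
  qed
  moreover have "module.submodule_sum (module_vec TYPE(complex) ?N) W W' = carrier_vec ?N"
    unfolding submodule_sum_module_vec
  proof
    show "{v + w |v w. v \<in> W \<and> w \<in> W'} \<subseteq> carrier_vec ?N" by (auto simp: W_def W'_def)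
    show "carrier_vec ?N \<subseteq> {v + w |v w. v \<in> W \<and> w \<in> W'}"
    proof
      fix u :: "complex vec" assume u: "u \<in> carrier_vec ?N"
      \<comment> \<open>As \<open>glue_fixed n p\<close> is 1 at \<open>{..<n}\<close>, this
        multiple carries the whole top coordinate of \<open>u\<close>.\<close>
      let ?v = "set_vec n (\<lambda>I. u $ ?top * ?z I)"
      have v: "?v \<in> carrier_vec ?N" "?v \<in> W" by (auto simp: W_def)
      have "u - ?v \<in> W'" using u v(1) top W_top by (simp add: W'_def)
      moreover have "u = ?v + (u - ?v)" using u v(1) by auto
      ultimately show "u \<in> {v + w |v w. v \<in> W \<and> w \<in> W'}" using v(2) by blast
    qed
  qed
  ultimately show ?thesis unfolding indecomposable_def using W W' by blast
qed

theorem proposition5p6: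
  fixes q p :: complex and n :: nat
  assumes "q \<noteq> 0"
  shows "(3 \<le> n \<and> q \<noteq> p \<longrightarrow> indecomposable (MD n) (2 ^ n) (md_rep n (glue_mat q) (glue_mat p)))
       \<and> (1 \<le> n \<and> q = p \<longrightarrow> \<not> indecomposable (MD n) (2 ^ n) (md_rep n (glue_mat q) (glue_mat p)))"
  using indecomposable_glue not_indecomposable_glue by blast

end
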